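(* Let $q=2^e$ with $e>1$ odd, $\sigma=2^{(e+1)/2}$, let $\delta\in\mathbb{F}_q$ have absolute trace $1$ and let $\varepsilon=\epsilon\in\mathbb{F}_{q^2}\setminus\mathbb{F}_q$ satisfy $\epsilon^2+\epsilon+\delta=0$. For $x\in\mathbb{F}_{q^2}$ set \[ \Gamma_\varepsilon(x)=[x+(x^q+x)\varepsilon]^{\sigma+2}+(x^q+x)^{\sigma}+(x^{2q}+x^2)\varepsilon+x^{q+1}+x^2, \] and let $\mathcal{H}^3_\varepsilon$ be the BT quasi-Hermitian variety of $\mathrm{PG}(3,q^2)$, namely the union of the affine points $(1,x,y,z)$ satisfying $z^q+z=\Gamma_\varepsilon(x)+\Gamma_\varepsilon(y)$ and the set $\mathcal{F}=\{(0,X,Y,Z): X^{q+1}+Y^{q+1}=0\}$. Then in the Barlotti--Cofman representation in $\mathrm{PG}(6,q)$ the affine points of $\mathcal{H}^3_\varepsilon$ correspond to the affine points of the hypersurface \[ \mathcal{C}^3_\varepsilon:\ x_0^{\sigma+1}x_6=x_1^{\sigma+2}+x_0^{\sigma}x_1x_2+x_0^2x_2^{\sigma}+x_3^{\sigma+2}+x_0^{\sigma}x_3x_4+x_0^2x_4^{\sigma}; \] equivalently, to the affine points of the union of the lines joining $V=(0,0,0,0,0,1,0)$ to the points of $\mathcal{C}^3_\varepsilon\cap\{x_5=0\}$. The points at infinity of $\mathcal{H}^3_\varepsilon$ are represented by the $q^3+q^2+1$ spread lines $r_P$, $P\in\mathcal{F}$, and among these lines exactly $q^2+1$ are contained in 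$\mathcal{C}^3_\varepsilon$.
   Context: Points of $\mathrm{PG}(3,q^2)$ have homogeneous coordinates $(J,X,Y,Z)$, with plane at infinity $J=0$; points of $\mathrm{PG}(6,q)$ have homogeneous coordinates $(x_0,\dots,x_6)$, with hyperplane at infinity $x_0=0$; $x^{\sigma+m}$ means $x^{2^{(e+1)/2}+m}$. Every $c\in\mathbb{F}_{q^2}$ is written uniquely as $c=c_0+\epsilon c_1$, $c_0,c_1\in\mathbb{F}_q$. Barlotti--Cofman representation: the affine point $(1,x,y,z)$ with $x=x_1+\epsilon x_2$, $y=x_3+\epsilon x_4$, $z=x_5+\epsilon x_6$ corresponds to $(1,x_1,\dots,x_6)$; a point $P=(0,u,v,w)$ at infinity corresponds to the spread line $r_P$ of $\{x_0=0\}$ consisting of the points $(0,u'_0,u'_1,v'_0,v'_1,w'_0,w'_1)$ with $(u',v',w')=(\lambda u,\lambda v,\lambda w)$, $\lambda\in\mathbb{F}_{q^2}^*$. These lines form a Desarguesian line spread of $\{x_0=0\}$. *)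

theory Defs
  imports "HOL-Analysis.Cartesian_Space" "HOL-Library.Numeral_Type"
begin

section \<open>Projective spaces\<close>

text \<open>The points of the projective space of \<open>'a ^ 'n\<close> are the one-dimensional subspaces; a
  projective line is identified with the set of its points.  Coordinates are indexed by the
  numeral types \<open>4\<close> and \<open>7\<close>, whose elements are \<open>0, 1, 2, 3\<close> and \<open>0, \<dots>, 6\<close>.\<close>

definition proj_points :: "(('a::field) ^ 'n) set set" where
  "proj_points = {P. vec.subspace P \<and> vec.dim P = 1}"

definition pt :: "('a::field) ^ 'n \<Rightarrow> ('a ^ 'n) set" where
  "pt v = vec.span {v}"

definition is_proj_line :: "(('a::field) ^ 'n) set set \<Rightarrow> bool" where
  "is_proj_line L \<longleftrightarrow>
     (\<exists>W. vec.subspace W \<and> vec.dim W = 2 \<and> L = {R \<in> proj_points. R \<subseteq> W})"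

definition join_line :: "(('a::field) ^ 'n) set \<Rightarrow> ('a ^ 'n) set \<Rightarrow> ('a ^ 'n) set set" where
  "join_line P Q = {R \<in> proj_points. R \<subseteq> vec.span (P \<union> Q)}"

definition infinite_points :: "(('a::field) ^ ('n::{finite,zero})) set set" where
  "infinite_points = {P \<in> proj_points. \<forall>v\<in>P. v $ 0 = 0}"

definition affine_points :: "(('a::field) ^ ('n::{finite,zero})) set set" where
  "affine_points = proj_points - infinite_points"

definition vec4 :: "'a \<Rightarrow> 'a \<Rightarrow> 'a \<Rightarrow> 'a \<Rightarrow> 'a ^ 4" where
  "vec4 a b c d = (\<chi> i. if i = 0 then a else if i = 1 then b else if i = 2 then c else d)"

definition vec7 :: "'a \<Rightarrow> 'a \<Rightarrow> 'a \<Rightarrow> 'a \<Rightarrow> 'a \<Rightarrow> 'a \<Rightarrow> 'a \<Rightarrow> 'a ^ 7" where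
  "vec7 a b c d e f g =
     (\<chi> i. if i = 0 then a else if i = 1 then b else if i = 2 then c else if i = 3 then d
          else if i = 4 then e else if i = 5 then f else g)"


section \<open>Finite fields\<close>

text \<open>The inclusion of $F_q$ into $F_{q^2}$ is an explicit map between two field types.\<close>

definition field_embedding :: "('k::field \<Rightarrow> 'l::field) \<Rightarrow> bool" where
  "field_embedding \<iota> \<longleftrightarrow>
     \<iota> 1 = 1 \<and> (\<forall>a b. \<iota> (a + b) = \<iota> a + \<iota> b) \<and> (\<forall>a b. \<iota> (a * b) = \<iota> a * \<iota> b)"

text \<open>The trace of the field with \<open>2 ^ e\<close> elements over its prime field.\<close>

definition abs_trace :: "nat \<Rightarrow> 'k::field \<Rightarrow> 'k" where
  "abs_trace e x = (\<Sum>i<e. x ^ (2 ^ i))"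

text \<open>The pair $(c_0, c_1)$ with $c = c_0 + \varepsilon c_1$.\<close>

definition comps :: "('k::field \<Rightarrow> 'l::field) \<Rightarrow> 'l \<Rightarrow> 'l \<Rightarrow> 'k \<times> 'k" where
  "comps \<iota> \<epsilon> c = (THE p. c = \<iota> (fst p) + \<epsilon> * \<iota> (snd p))"


section \<open>The BT quasi-Hermitian variety\<close>

definition BT_Gamma :: "nat \<Rightarrow> nat \<Rightarrow> 'l::field \<Rightarrow> 'l \<Rightarrow> 'l" where
  "BT_Gamma q \<sigma> \<epsilon> x =
     (x + (x ^ q + x) * \<epsilon>) ^ (\<sigma> + 2) + (x ^ q + x) ^ \<sigma>
       + (x ^ (2 * q) + x ^ 2) * \<epsilon> + x ^ (q + 1) + x ^ 2"

definition BT_infinity :: "nat \<Rightarrow> (('l::field) ^ 4) set set" where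
  "BT_infinity q =
     {pt (vec4 0 X Y Z) | X Y Z. (X, Y, Z) \<noteq> (0, 0, 0) \<and> X ^ (q + 1) + Y ^ (q + 1) = 0}"

definition BT_variety :: "nat \<Rightarrow> nat \<Rightarrow> 'l::field \<Rightarrow> ('l ^ 4) set set" where
  "BT_variety q \<sigma> \<epsilon> =
     {pt (vec4 1 x y z) | x y z. z ^ q + z = BT_Gamma q \<sigma> \<epsilon> x + BT_Gamma q \<sigma> \<epsilon> y}
       \<union> BT_infinity q"


section \<open>The Barlotti--Cofman representation\<close>

definition bc_vec :: "('k::field \<Rightarrow> 'l::field) \<Rightarrow> 'l \<Rightarrow> 'k \<Rightarrow> 'l \<Rightarrow> 'l \<Rightarrow> 'l \<Rightarrow> 'k ^ 7" where
  "bc_vec \<iota> \<epsilon> a x y z =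
     vec7 a (fst (comps \<iota> \<epsilon> x)) (snd (comps \<iota> \<epsilon> x))
            (fst (comps \<iota> \<epsilon> y)) (snd (comps \<iota> \<epsilon> y))
            (fst (comps \<iota> \<epsilon> z)) (snd (comps \<iota> \<epsilon> z))"

text \<open>Only meaningful for affine points \<open>P\<close>, where \<open>x\<close>, \<open>y\<close>, \<open>z\<close> are unique.\<close>

definition bc_point :: "('k::field \<Rightarrow> 'l::field) \<Rightarrow> 'l \<Rightarrow> ('l ^ 4) set \<Rightarrow> ('k ^ 7) set" where
  "bc_point \<iota> \<epsilon> P =
     (THE Q. \<exists>x y z. P = pt (vec4 1 x y z) \<and> Q = pt (bc_vec \<iota> \<epsilon> 1 x y z))"

text \<open>The line $r_P$, for points \<open>P\<close> at infinity; it does not depend on the representative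
  $(0,u,v,w)$ of \<open>P\<close>.\<close>

definition bc_line :: "('k::field \<Rightarrow> 'l::field) \<Rightarrow> 'l \<Rightarrow> ('l ^ 4) set \<Rightarrow> ('k ^ 7) set set" where
  "bc_line \<iota> \<epsilon> P =
     {pt (bc_vec \<iota> \<epsilon> 0 (l * u) (l * v) (l * w)) | l u v w. l \<noteq> 0 \<and> P = pt (vec4 0 u v w)}"


section \<open>The hypersurface and the cone in $PG(6,q)$\<close>

text \<open>The equation is homogeneous of degree \<open>\<sigma> + 2\<close>, so it does not depend on the
  representative of a point.\<close>

definition BT_hypersurface :: "nat \<Rightarrow> (('k::field) ^ 7) set set" where
  "BT_hypersurface \<sigma> =
     {pt x | x. x \<noteq> 0 \<and>
        (x $ 0) ^ (\<sigma> + 1) * x $ 6 =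
          (x $ 1) ^ (\<sigma> + 2) + (x $ 0) ^ \<sigma> * x $ 1 * x $ 2 + (x $ 0) ^ 2 * (x $ 2) ^ \<sigma>
          + (x $ 3) ^ (\<sigma> + 2) + (x $ 0) ^ \<sigma> * x $ 3 * x $ 4 + (x $ 0) ^ 2 * (x $ 4) ^ \<sigma>}"

definition BT_cone :: "nat \<Rightarrow> (('k::field) ^ 7) set set" where
  "BT_cone \<sigma> =
     (\<Union>Q \<in> {Q \<in> BT_hypersurface \<sigma>. \<forall>v\<in>Q. v $ 5 = 0}. join_line (pt (vec7 0 0 0 0 0 1 0)) Q)"

end

theory Submission
  imports Defs "HOL-Computational_Algebra.Primes" "HOL-Computational_Algebra.Polynomial"
begin

text \<open>Conjugation in $F_{q^2}$ maps $\varepsilon$ to $\varepsilon + 1$, so for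
  $x = a + \varepsilon b$ the trace $x^q + x$ is $b$ and $\Gamma_\varepsilon(x)$ collapses to
  $a^{\sigma+2} + ab + b^\sigma$: the affine equation of the variety is literally that of the
  hypersurface.  It does not involve $x_5$, whence the cone.  At infinity the hypersurface has the
  equation $x_1^{\sigma+2} = x_3^{\sigma+2}$, which means $x_1 = x_3$ because
  $\gcd(\sigma + 2, q - 1) = 1$; hence the spread line of $(0,X,Y,Z)$ lies on it iff $X = Y$.\<close>

section \<open>Points and coordinates\<close>

lemma forall_7: "(\<forall>i::7. P i) \<longleftrightarrow> P 0 \<and> P 1 \<and> P 2 \<and> P 3 \<and> P 4 \<and> P 5 \<and> P 6"
proof -
  have "UNIV = {0, 1, 2, 3, 4, 5, 6 :: 7}"
    by (rule sym, rule card_subset_eq) auto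
  then show ?thesis
    by (metis UNIV_I insert_iff empty_iff)
qed

lemma forall_4': "(\<forall>i::4. P i) \<longleftrightarrow> P 0 \<and> P 1 \<and> P 2 \<and> P 3"
proof -
  \<comment> \<open>\<open>forall_4\<close> runs over the indices 1 to 4; in this type the last of
    them wraps around to 0.\<close>
  have "(4::4) = 0" by simp
  then show ?thesis using forall_4[of P] by metis
qed

lemma vec4_nth [simp]:
  "vec4 a b c d $ 0 = a" "vec4 a b c d $ 1 = b" "vec4 a b c d $ 2 = c" "vec4 a b c d $ 3 = d"
  by (simp_all add: vec4_def)

lemma vec7_nth [simp]:
  "vec7 a b c d f g h $ 0 = a" "vec7 a b c d f g h $ 1 = b" "vec7 a b c d f g h $ 2 = c"
  "vec7 a b c d f g h $ 3 = d" "vec7 a b c d f g h $ 4 = f" "vec7 a b c d f g h $ 5 = g"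
  "vec7 a b c d f g h $ 6 = h"
  by (simp_all add: vec7_def)

lemma vec4_eq_iff: "x = y \<longleftrightarrow> x $ 0 = y $ 0 \<and> x $ 1 = y $ 1 \<and> x $ 2 = y $ 2 \<and> x $ 3 = y $ 3"
  for x y :: "'a ^ 4"
  by (simp add: vec_eq_iff forall_4')

lemma vec7_eq_iff:
  "x = y \<longleftrightarrow> x $ 0 = y $ 0 \<and> x $ 1 = y $ 1 \<and> x $ 2 = y $ 2 \<and> x $ 3 = y $ 3 \<and> x $ 4 = y $ 4
     \<and> x $ 5 = y $ 5 \<and> x $ 6 = y $ 6"
  for x y :: "'a ^ 7"
  by (simp add: vec_eq_iff forall_7)

lemma mem_pt: "v \<in> pt w \<longleftrightarrow> (\<exists>c. v = c *s w)"
  by (auto simp: pt_def vec.span_singleton)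

lemma self_mem_pt: "v \<in> pt v"
  unfolding pt_def by (rule vec.span_base) simp

lemma pt_scale: "c \<noteq> 0 \<Longrightarrow> pt (c *s v) = pt v"
proof (intro set_eqI iffI)
  fix w assume c: "c \<noteq> 0"
  { assume "w \<in> pt (c *s v)" then show "w \<in> pt v"
      by (auto simp: mem_pt) }
  { assume "w \<in> pt v"
    then obtain d where "w = d *s v" by (auto simp: mem_pt)
    with c have "w = (d / c) *s (c *s v)" by simp
    then show "w \<in> pt (c *s v)" unfolding mem_pt by (rule exI) }
qed

lemma pt_eq_iff: "pt v = pt w \<longleftrightarrow> (\<exists>c. c \<noteq> 0 \<and> v = c *s w)"
proof
  assume eq: "pt v = pt w"
  obtain c where c: "v = c *s w"
    using self_mem_pt[of v] by (auto simp: eq mem_pt)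
  obtain d where d: "w = d *s v"
    using self_mem_pt[of w] by (auto simp: mem_pt simp flip: eq)
  show "\<exists>c. c \<noteq> 0 \<and> v = c *s w"
  proof (cases "c = 0")
    \<comment> \<open>Both vectors vanish here, so any nonzero scalar serves as witness.\<close>
    case True
    with c d have "v = 1 *s w" by simp
    then show ?thesis by (metis one_neq_zero)
  qed (use c in blast)
qed (auto simp: pt_scale)

lemma mem_proj_points: "P \<in> proj_points \<longleftrightarrow> (\<exists>v. v \<noteq> 0 \<and> P = pt v)"
proof
  assume "P \<in> proj_points"
  then have P: "vec.subspace P" "vec.dim P = 1" by (auto simp: proj_points_def)
  have "\<not> P \<subseteq> {0}"
    using P(2) by (metis vec.dim_eq_0 zero_neq_one)
  then obtain v where v: "v \<in> P" "v \<noteq> 0" by auto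
  have "pt v = P"
    unfolding pt_def
    by (rule vec.subspace_dim_equal) (use P v in \<open>auto intro: vec.span_minimal[THEN subsetD]\<close>)
  with v show "\<exists>v. v \<noteq> 0 \<and> P = pt v" by auto
qed (auto simp: proj_points_def pt_def)

lemma pt_in_proj_points [simp]: "pt v \<in> proj_points \<longleftrightarrow> v \<noteq> 0"
proof
  assume "pt v \<in> proj_points"
  then obtain w where "w \<noteq> 0" "pt v = pt w" by (auto simp: mem_proj_points)
  then show "v \<noteq> 0" by (auto simp: pt_eq_iff)
qed (auto simp: mem_proj_points)

lemma pt_in_infinite_points [simp]: "pt v \<in> infinite_points \<longleftrightarrow> v \<noteq> 0 \<and> v $ 0 = 0"
proof -
  have "(\<forall>w\<in>pt v. w $ 0 = 0) \<longleftrightarrow> v $ 0 = 0"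
    using self_mem_pt[of v] by (auto simp: mem_pt)
  then show ?thesis by (simp add: infinite_points_def)
qed

lemma pt_in_affine_points [simp]: "pt v \<in> affine_points \<longleftrightarrow> v $ 0 \<noteq> 0"
  by (auto simp: affine_points_def)

text \<open>Dividing by the nonzero coordinate 0 normalizes a representative;
  \<open>pt_eq_affine_iff\<close> then turns equality of affine points into equality of
  vectors.\<close>

lemma affine_point_cases:
  assumes "P \<in> affine_points"
  obtains v where "v $ 0 = 1" "P = pt v"
proof -
  from assms obtain w where w: "P = pt w" "w $ 0 \<noteq> 0"
    by (auto simp: affine_points_def mem_proj_points)
  show thesis
    by (rule that[of "(1 / w $ 0) *s w"]) (use w in \<open>auto simp: pt_scale\<close>)
qed

lemma pt_eq_affine_iff:
  assumes "v $ 0 = 1" "w $ 0 = 1"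
  shows "pt v = pt w \<longleftrightarrow> v = w"
proof
  assume "pt v = pt w"
  then obtain c where "v = c *s w" by (auto simp: pt_eq_iff)
  with assms show "v = w" by simp
qed simp

lemma pt_subset_iff: "vec.subspace W \<Longrightarrow> pt v \<subseteq> W \<longleftrightarrow> v \<in> W"
  unfolding pt_def by (metis insert_subset empty_subsetI vec.span_minimal vec.span_superset order_trans)

lemma pt_in_join_line: "pt v \<in> join_line (pt a) (pt b) \<longleftrightarrow> v \<noteq> 0 \<and> (\<exists>c d. v = c *s a + d *s b)"
proof -
  have "vec.span (pt a \<union> pt b) = {c *s a + d *s b | c d. True}"
    unfolding pt_def vec.span_Un vec.span_span by (auto simp: vec.span_singleton)
  moreover have "pt v \<subseteq> vec.span (pt a \<union> pt b) \<longleftrightarrow> v \<in> vec.span (pt a \<union> pt b)"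
    by (rule pt_subset_iff[OF vec.subspace_span])
  ultimately show ?thesis
    by (simp add: join_line_def)
qed

section \<open>Finite fields of characteristic two\<close>

text \<open>Translation by 1 permutes the field, so summing 1 over all elements gives 0. Hence the
  characteristic, a prime, divides \<open>2 ^ n\<close>.\<close>

lemma char_two:
  assumes "CARD('a::{field,finite}) = 2 ^ n"
  shows "CHAR('a) = 2"
proof -
  have "(\<Sum>x\<in>UNIV. x + 1) = (\<Sum>x\<in>(UNIV :: 'a set). x)"
    by (rule sum.reindex_bij_witness[of _ "\<lambda>x. x - 1" "\<lambda>x. x + 1"]) auto
  then have "(of_nat (2 ^ n) :: 'a) = 0"
    by (simp add: sum.distrib flip: assms)
  then have "CHAR('a) dvd 2 ^ n"
    by (simp only: of_nat_eq_0_iff_char_dvd)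
  moreover have "prime CHAR('a)"
    using prime_CHAR_semidom[where ?'a = 'a] finite_imp_CHAR_pos[where ?'a = 'a] by simp
  ultimately show ?thesis
    by (meson prime_dvd_power primes_dvd_imp_eq two_is_prime_nat)
qed

text \<open>Multiplication by a nonzero \<open>x\<close> permutes the units; comparing the products
  over all units gives \<open>x ^ (CARD('a) - 1) = 1\<close>.\<close>

lemma power_card_eq_self:
  fixes x :: "'a::{field,finite}"
  shows "x ^ CARD('a) = x"
proof (cases "x = 0")
  case False
  have "(\<Prod>y\<in>UNIV-{0}. y) = (\<Prod>y\<in>UNIV-{0}. x * y)"
    by (rule prod.reindex_bij_witness[of _ "\<lambda>y. x * y" "\<lambda>y. y / x"]) (use False in auto)
  also have "\<dots> = x ^ (CARD('a) - 1) * (\<Prod>y\<in>UNIV-{0}. y)"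
    by (simp add: prod.distrib)
  finally have "x ^ (CARD('a) - 1) = 1" by simp
  then show ?thesis
    by (metis power_minus_mult zero_less_card_finite mult_1)
qed simp

text \<open>The elements counted are the roots of the polynomial X^n - c, which has degree
  \<open>n\<close>.\<close>

lemma card_power_eq_le:
  fixes c :: "'a::field"
  assumes "n > 0"
  shows "card {x. x ^ n = c} \<le> n"
proof -
  let ?p = "monom 1 n + [:- c:]"
  have deg: "degree ?p = n"
    using assms degree_add_eq_left[of "[:- c:]" "monom 1 n"] by (simp add: degree_monom_eq)
  with assms have "?p \<noteq> 0" by auto
  from card_poly_roots_bound[OF this] show ?thesis
    by (simp add: deg poly_monom)
qed

text \<open>The fibres of the norm $y \mapsto y^{q+1}$ partition the $(q+1)(q-1)$ units; there are at
  most $q-1$ of them, with at most $q+1$ elements each, so every fibre is full.\<close>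

lemma card_norm_one:
  assumes "CARD('a::{field,finite}) = q ^ 2" "q > 1"
  shows "card {y::'a. y ^ (q + 1) = 1} = q + 1"
proof -
  define C where "C = {c::'a. c ^ (q - 1) = 1}"
  have units: "y ^ (q + 1) \<in> C" if "y \<noteq> 0" for y :: 'a
  proof -
    have "y ^ (q ^ 2 - 1) * y = y"
      using power_card_eq_self[of y] assms
      by (metis power_minus_mult zero_less_power order_less_trans zero_less_one)
    with that have "y ^ (q ^ 2 - 1) = 1" by simp
    moreover have "q ^ 2 - 1 = (q + 1) * (q - 1)"
      using assms by (cases q) (auto simp: power2_eq_square)
    ultimately show ?thesis
      by (simp only: C_def mem_Collect_eq power_mult)
  qed
  have C: "card C \<le> q - 1" unfolding C_def
    by (rule card_power_eq_le) (use assms in auto)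
  have one: "1 \<in> C" by (simp add: C_def)
  have "UNIV - {0::'a} \<subseteq> (\<Union>c\<in>C. {y. y ^ (q + 1) = c})"
    using units by auto
  then have "card (UNIV - {0::'a}) \<le> card (\<Union>c\<in>C. {y. y ^ (q + 1) = c})"
    by (intro card_mono) auto
  also have "\<dots> \<le> (\<Sum>c\<in>C. card {y. y ^ (q + 1) = c})"
    by (rule card_UN_le) auto
  \<comment> \<open>The fibre over 1 is kept exact and only the other fibres are estimated, which
    leaves at least \<open>q + 1\<close> elements for it.\<close>
  also have "\<dots> = card {y::'a. y ^ (q + 1) = 1} + (\<Sum>c\<in>C-{1}. card {y. y ^ (q + 1) = c})"
    using one by (subst sum.remove[of _ 1]) auto
  also have "(\<Sum>c\<in>C-{1}. card {y. y ^ (q + 1) = c}) \<le> (\<Sum>c\<in>C-{1}. q + 1)"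
    by (intro sum_mono card_power_eq_le) auto
  also have "\<dots> \<le> (q - 2) * (q + 1)"
  proof -
    have "card (C - {1}) \<le> q - 2" using C one by simp
    then show ?thesis by (metis sum_constant of_nat_id mult_le_mono1)
  qed
  finally have "q ^ 2 - 1 \<le> card {y::'a. y ^ (q + 1) = 1} + (q - 2) * (q + 1)"
    using assms by simp
  moreover have "q ^ 2 - 1 = (q + 1) + (q - 2) * (q + 1)"
  proof -
    \<comment> \<open>This substitution removes the truncated subtractions.\<close>
    from assms obtain m where "q = m + 2"
      by (metis Suc_1 Suc_leI add.commute le_Suc_ex)
    then show ?thesis by (simp add: power2_eq_square)
  qed
  ultimately have "q + 1 \<le> card {y::'a. y ^ (q + 1) = 1}" by linarith
  with card_power_eq_le[of "q + 1" "1::'a"] show ?thesis by simp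
qed


section \<open>Cancellation and the Frobenius map in characteristic two\<close>

lemma add_self_char_two:
  fixes a :: "'a::field"
  assumes "CHAR('a) = 2"
  shows "a + a = 0"
proof -
  have "of_nat 2 = (0::'a)"
    unfolding of_nat_eq_0_iff_char_dvd assms by simp
  then show ?thesis by (metis mult_2 mult_zero_left of_nat_numeral)
qed

lemma add_eq_0_iff_char_two:
  fixes a b :: "'a::field"
  assumes "CHAR('a) = 2"
  shows "a + b = 0 \<longleftrightarrow> a = b"
  using add_self_char_two[OF assms, of b] by (metis add_right_cancel)

lemma frobenius_add:
  fixes a b :: "'a::field"
  assumes "CHAR('a) = 2"
  shows "(a + b) ^ (2 ^ n) = a ^ (2 ^ n) + b ^ (2 ^ n)"
  by (rule freshmans_dream') (simp_all add: assms)

text \<open>The map is additive, and its kernel is trivial because a field has no nonzero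
  nilpotents.\<close>

lemma power_two_power_inj:
  fixes a b :: "'a::field"
  assumes "CHAR('a) = 2" "a ^ (2 ^ n) = b ^ (2 ^ n)"
  shows "a = b"
proof -
  have "(a + b) ^ (2 ^ n) = 0"
    using assms by (simp add: frobenius_add add_self_char_two)
  then have "a + b = 0" by simp
  then show ?thesis by (simp only: add_eq_0_iff_char_two[OF assms(1)])
qed

text \<open>If $r^{2^m+1} = 1$, then $r^{2^{2m}} = r$, so $r = r^{2^{2m+1}} = r^2$.\<close>

lemma power_sigma_plus_two_inj:
  fixes a b :: "'a::{field,finite}"
  assumes card: "CARD('a) = 2 ^ (2 * m + 1)" and eq: "a ^ (2 ^ (m + 1) + 2) = b ^ (2 ^ (m + 1) + 2)"
  shows "a = b"
proof (cases "b = 0")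
  case True
  then have "a ^ (2 ^ (m + 1) + 2) = 0" using eq by simp
  then show ?thesis using True by simp
next
  case False
  have char: "CHAR('a) = 2" by (rule char_two[OF card])
  define r where "r = a / b"
  \<comment> \<open>The exponent 2^(m+1) + 2 is twice 2^m + 1. The outer square is written
    \<open>2 ^ 1\<close> so that \<open>power_two_power_inj\<close> can strip it.\<close>
  have "(r ^ (2 ^ m + 1)) ^ 2 ^ 1 = r ^ (2 ^ (m + 1) + 2)"
  proof -
    have "2 ^ (m + 1) + 2 = (2 ^ m + 1) * (2 ^ 1 :: nat)" by simp
    then show ?thesis by (simp only: power_mult)
  qed
  also have "\<dots> = 1 ^ 2 ^ 1"
    using eq False by (simp add: r_def power_divide)
  finally have "r ^ (2 ^ m + 1) = 1"
    by (rule power_two_power_inj[OF char])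
  then have inv: "r ^ 2 ^ m * r = 1" by (simp add: mult.commute)
  then have "r \<noteq> 0" by auto
  \<comment> \<open>Comparing this power of \<open>inv\<close> with \<open>inv\<close> itself allows
    \<open>r ^ 2 ^ m\<close> to be cancelled.\<close>
  have "(r ^ 2 ^ m * r) ^ 2 ^ m = 1" by (simp add: inv)
  then have "r ^ (2 ^ m * 2 ^ m) * r ^ 2 ^ m = r * r ^ 2 ^ m"
    using inv by (simp add: power_mult_distrib power_mult mult.commute)
  with \<open>r \<noteq> 0\<close> have "r ^ (2 ^ m * 2 ^ m) = r" by simp
  moreover have "(r ^ (2 ^ m * 2 ^ m)) ^ 2 = r ^ CARD('a)"
  proof -
    have "(2 ^ m * 2 ^ m) * 2 = (2 ^ (2 * m + 1) :: nat)" by (simp add: mult_2 power_add)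
    then show ?thesis by (simp only: card power_mult[symmetric])
  qed
  ultimately have "r ^ 2 = r" by (simp add: power_card_eq_self)
  with \<open>r \<noteq> 0\<close> have "r = 1" by (simp add: power2_eq_square)
  with False show ?thesis by (simp add: r_def)
qed

section \<open>The quadratic extension\<close>

locale BT_setting =
  fixes \<iota> :: "'k::{field,finite} \<Rightarrow> 'l::{field,finite}"
    and \<delta> :: 'k and \<epsilon> :: 'l and e q \<sigma> :: nat
  assumes odd_e: "odd e" and e_gt_1: "e > 1"
    and q: "q = 2 ^ e" and \<sigma>: "\<sigma> = 2 ^ ((e + 1) div 2)"
    and card_k: "CARD('k) = q" and card_l: "CARD('l) = q ^ 2" and emb: "field_embedding \<iota>"
    and \<epsilon>_notin: "\<epsilon> \<notin> range \<iota>" and \<epsilon>_eq: "\<epsilon> ^ 2 + \<epsilon> + \<iota> \<delta> = 0"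
begin

lemma \<iota>_1 [simp]: "\<iota> 1 = 1" and \<iota>_add: "\<iota> (a + b) = \<iota> a + \<iota> b" and \<iota>_mult: "\<iota> (a * b) = \<iota> a * \<iota> b"
  using emb by (auto simp: field_embedding_def)

lemma \<iota>_0 [simp]: "\<iota> 0 = 0"
  by (metis \<iota>_add add_0 add_cancel_right_right)

lemma \<iota>_power: "\<iota> (a ^ n) = \<iota> a ^ n"
  by (induction n) (simp_all add: \<iota>_mult)

text \<open>A nonzero \<open>a\<close> has an inverse, so its image divides 1 and cannot
  vanish.\<close>

lemma \<iota>_eq_0_iff [simp]: "\<iota> a = 0 \<longleftrightarrow> a = 0"
proof
  assume "\<iota> a = 0"
  then have "\<iota> (a * (1 / a)) = 0" by (simp only: \<iota>_mult mult_zero_left)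
  then show "a = 0" by (cases "a = 0") auto
qed simp

lemma char_k: "CHAR('k) = 2"
  using card_k q char_two by metis

lemma char_l: "CHAR('l) = 2"
  by (rule char_two[of "e * 2"]) (simp add: card_l q power_mult)

lemmas add_self_l = add_self_char_two[OF char_l]
lemmas add_eq_0_iff_l = add_eq_0_iff_char_two[OF char_l]
lemmas add_eq_0_iff_k = add_eq_0_iff_char_two[OF char_k]

lemma two_eq_0_l: "(2::'l) = 0"
  using add_self_l[of 1] by simp

text \<open>Cancels a repeated summand inside a right-nested sum. Together with
  \<open>add_self_l\<close> it lets \<open>char_two_simps\<close> settle polynomial identities in
  characteristic two.\<close>

lemma add_self_left_l: "a + (a + b) = (b::'l)"
  by (simp add: add_self_l flip: add.assoc)

lemmas char_two_simps = two_eq_0_l add_self_l add_self_left_l algebra_simps power2_eq_square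

lemma \<iota>_eq_iff [simp]: "\<iota> a = \<iota> b \<longleftrightarrow> a = b"
  by (metis \<iota>_add \<iota>_eq_0_iff add_eq_0_iff_k add_eq_0_iff_l)

text \<open>Linear independence of 1 and \<open>\<epsilon>\<close> over the subfield: if
  \<open>b \<noteq> d\<close>, solving for \<open>\<epsilon>\<close> gives (a + c) / (b + d), an
  element of the range of \<open>\<iota>\<close>.\<close>

lemma decomp_unique: "\<iota> a + \<epsilon> * \<iota> b = \<iota> c + \<epsilon> * \<iota> d \<longleftrightarrow> a = c \<and> b = d"
proof
  assume eq: "\<iota> a + \<epsilon> * \<iota> b = \<iota> c + \<epsilon> * \<iota> d"
  have "b = d"
  proof (rule ccontr)
    assume "b \<noteq> d"
    then have nz: "b + d \<noteq> 0" by (simp add: add_eq_0_iff_k)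
    have "\<epsilon> * \<iota> (b + d) = \<iota> (a + c)"
    proof -
      have "\<epsilon> * \<iota> (b + d) = \<iota> (a + c) + ((\<iota> a + \<epsilon> * \<iota> b) + (\<iota> c + \<epsilon> * \<iota> d))"
        by (simp add: \<iota>_add char_two_simps)
      then show ?thesis by (simp add: eq add_self_l)
    qed
    then have "\<epsilon> * \<iota> ((b + d) * (1 / (b + d))) = \<iota> ((a + c) * (1 / (b + d)))"
      unfolding \<iota>_mult by (metis mult.assoc)
    with nz have "\<epsilon> = \<iota> ((a + c) * (1 / (b + d)))" by simp
    with \<epsilon>_notin show False by blast
  qed
  with eq show "a = c \<and> b = d" by simp
qed simp

text \<open>The map from pairs is injective and both sides have \<open>q ^ 2\<close> elements, so it
  is onto.\<close>

lemma decomp_ex: "\<exists>a b. c = \<iota> a + \<epsilon> * \<iota> b"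
proof -
  let ?f = "\<lambda>(a, b). \<iota> a + \<epsilon> * \<iota> b"
  have "inj ?f" by (auto simp: inj_def decomp_unique)
  then have "card (range ?f) = CARD('l)"
    by (simp add: card_image card_k card_l power2_eq_square)
  then have "range ?f = UNIV"
    by (intro card_subset_eq) auto
  then have "c \<in> range ?f" by simp
  then show ?thesis by auto
qed

section \<open>Coordinates over the subfield\<close>

lemma comps_decomp [simp]: "comps \<iota> \<epsilon> (\<iota> a + \<epsilon> * \<iota> b) = (a, b)"
  unfolding comps_def by (rule the_equality) (auto simp: decomp_unique)

lemma decomp_comps: "\<iota> (fst (comps \<iota> \<epsilon> c)) + \<epsilon> * \<iota> (snd (comps \<iota> \<epsilon> c)) = c"
  using decomp_ex[of c] by auto

lemma comps_eq_iff [simp]: "comps \<iota> \<epsilon> c = comps \<iota> \<epsilon> d \<longleftrightarrow> c = d"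
  by (metis decomp_comps)

lemma comps_of_k [simp]: "comps \<iota> \<epsilon> (\<iota> a) = (a, 0)"
  using comps_decomp[of a 0] by simp

lemma comps_0 [simp]: "comps \<iota> \<epsilon> 0 = (0, 0)" and comps_1 [simp]: "comps \<iota> \<epsilon> 1 = (1, 0)"
  using comps_of_k[of 0] comps_of_k[of 1] by simp_all

lemma comps_add:
  "comps \<iota> \<epsilon> (c + d) = (fst (comps \<iota> \<epsilon> c) + fst (comps \<iota> \<epsilon> d), snd (comps \<iota> \<epsilon> c) + snd (comps \<iota> \<epsilon> d))"
proof -
  obtain a b a' b' where c: "c = \<iota> a + \<epsilon> * \<iota> b" and d: "d = \<iota> a' + \<epsilon> * \<iota> b'"
    using decomp_ex by metis
  have "c + d = \<iota> (a + a') + \<epsilon> * \<iota> (b + b')"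
    by (simp add: c d \<iota>_add algebra_simps)
  then have "comps \<iota> \<epsilon> (c + d) = (a + a', b + b')" by (simp only: comps_decomp)
  then show ?thesis by (simp add: c d)
qed

lemma comps_scale: "comps \<iota> \<epsilon> (\<iota> k * c) = (k * fst (comps \<iota> \<epsilon> c), k * snd (comps \<iota> \<epsilon> c))"
proof -
  obtain a b where c: "c = \<iota> a + \<epsilon> * \<iota> b"
    using decomp_ex by metis
  have "\<iota> k * c = \<iota> (k * a) + \<epsilon> * \<iota> (k * b)"
    by (simp add: c \<iota>_mult algebra_simps)
  then have "comps \<iota> \<epsilon> (\<iota> k * c) = (k * a, k * b)" by (simp only: comps_decomp)
  then show ?thesis by (simp add: c)
qed

section \<open>Conjugation, trace and the value of Gamma\<close>

lemma \<iota>_power_q: "\<iota> a ^ q = \<iota> a"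
  using power_card_eq_self[of a] by (metis \<iota>_power card_k)

lemma q_gt_1: "q > 1"
  unfolding q using e_gt_1 by (intro one_less_power) auto

text \<open>Raising the quadratic equation to the power \<open>q\<close> shows that the conjugate is
  again a root, hence \<open>\<epsilon>\<close> or \<open>\<epsilon> + 1\<close>; the first option
  is excluded by counting.\<close>

lemma \<epsilon>_power_q: "\<epsilon> ^ q = \<epsilon> + 1"
proof -
  have "(\<epsilon> ^ 2 + \<epsilon> + \<iota> \<delta>) ^ q = (\<epsilon> ^ 2) ^ q + \<epsilon> ^ q + \<iota> \<delta> ^ q"
    unfolding q by (simp only: frobenius_add[OF char_l])
  also have "(\<epsilon> ^ 2) ^ q = (\<epsilon> ^ q) ^ 2" by (simp add: mult.commute flip: power_mult)
  finally have "(\<epsilon> ^ q) ^ 2 + \<epsilon> ^ q + \<iota> \<delta> = 0"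
    using \<epsilon>_eq q_gt_1 by (simp add: \<iota>_power_q power_0_left)
  \<comment> \<open>The sum of the quadratic at its two arguments factors, since the constant terms
    cancel.\<close>
  moreover have "(\<epsilon> ^ q + \<epsilon>) * (\<epsilon> ^ q + (\<epsilon> + 1))
      = ((\<epsilon> ^ q) ^ 2 + \<epsilon> ^ q + \<iota> \<delta>) + (\<epsilon> ^ 2 + \<epsilon> + \<iota> \<delta>)"
    by (simp add: char_two_simps)
  ultimately have "(\<epsilon> ^ q + \<epsilon>) * (\<epsilon> ^ q + (\<epsilon> + 1)) = 0"
    by (simp only: \<epsilon>_eq add_0)
  then have "\<epsilon> ^ q = \<epsilon> \<or> \<epsilon> ^ q = \<epsilon> + 1"
    by (simp only: mult_eq_0_iff add_eq_0_iff_l)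
  moreover have "\<epsilon> ^ q \<noteq> \<epsilon>"
  proof
    assume fixed: "\<epsilon> ^ q = \<epsilon>"
    \<comment> \<open>If conjugation fixed \<open>\<epsilon>\<close>, it would fix the whole field,
      and all \<open>q ^ 2 - 1\<close> units would be roots of X^(q-1) - 1.\<close>
    have "c ^ q = c" for c :: 'l
    proof -
      obtain a b where c: "c = \<iota> a + \<epsilon> * \<iota> b" using decomp_ex by metis
      have "c ^ q = \<iota> a ^ q + (\<epsilon> * \<iota> b) ^ q"
        unfolding c q by (rule frobenius_add[OF char_l])
      then show ?thesis by (simp add: c power_mult_distrib fixed \<iota>_power_q)
    qed
    then have "c ^ (q - 1) = 1" if "c \<noteq> 0" for c :: 'l
      using that q_gt_1 by (metis mult_cancel_right1 power_minus_mult zero_less_power order_less_trans zero_less_one)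
    then have "UNIV - {0 :: 'l} \<subseteq> {c. c ^ (q - 1) = 1}" by auto
    then have "card (UNIV - {0 :: 'l}) \<le> card {c :: 'l. c ^ (q - 1) = 1}"
      by (intro card_mono) auto
    also have "\<dots> \<le> q - 1"
      by (rule card_power_eq_le) (use q_gt_1 in auto)
    finally have "q ^ 2 \<le> q" using q_gt_1 by (simp add: card_l)
    with q_gt_1 show False by (simp add: power2_eq_square)
  qed
  ultimately show ?thesis by simp
qed

lemma conj_decomp: "(\<iota> a + \<epsilon> * \<iota> b) ^ q = \<iota> a + \<epsilon> * \<iota> b + \<iota> b"
proof -
  have "(\<iota> a + \<epsilon> * \<iota> b) ^ q = \<iota> a ^ q + (\<epsilon> * \<iota> b) ^ q"
    unfolding q by (rule frobenius_add[OF char_l])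
  then show ?thesis
    by (simp add: power_mult_distrib \<iota>_power_q \<epsilon>_power_q algebra_simps)
qed

lemma trace_decomp: "(\<iota> a + \<epsilon> * \<iota> b) ^ q + (\<iota> a + \<epsilon> * \<iota> b) = \<iota> b"
  unfolding conj_decomp by (simp add: char_two_simps)

text \<open>The base of the first power is \<open>\<iota> a\<close> and the trace is
  \<open>\<iota> b\<close>. The last three terms of \<open>BT_Gamma\<close> together contribute only
  the product of the two.\<close>

lemma Gamma_decomp: "BT_Gamma q \<sigma> \<epsilon> (\<iota> a + \<epsilon> * \<iota> b) = \<iota> (a ^ (\<sigma> + 2) + a * b + b ^ \<sigma>)"
proof -
  let ?x = "\<iota> a + \<epsilon> * \<iota> b"
  have 1: "?x + \<iota> b * \<epsilon> = \<iota> a"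
    by (simp add: char_two_simps)
  have "?x ^ (2 * q) + ?x ^ 2 = (?x ^ q) ^ 2 + ?x ^ 2"
    by (simp add: power_mult mult.commute flip: power_mult)
  also have "\<dots> = \<iota> b ^ 2"
    unfolding conj_decomp by (simp add: char_two_simps)
  finally have 2: "?x ^ (2 * q) + ?x ^ 2 = \<iota> b ^ 2" .
  have 3: "?x ^ (q + 1) = (?x + \<iota> b) * ?x"
    by (simp add: conj_decomp mult.commute)
  have "BT_Gamma q \<sigma> \<epsilon> ?x
      = \<iota> a ^ (\<sigma> + 2) + \<iota> b ^ \<sigma> + (\<iota> b ^ 2 * \<epsilon> + (?x + \<iota> b) * ?x + ?x ^ 2)"
    unfolding BT_Gamma_def 1 2 3 trace_decomp by (simp add: add.assoc)
  \<comment> \<open>The norm and the square add up to \<open>\<iota> b * ?x\<close>, whose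
    \<open>\<epsilon>\<close> part cancels against the first term.\<close>
  also have "\<iota> b ^ 2 * \<epsilon> + (?x + \<iota> b) * ?x + ?x ^ 2 = \<iota> a * \<iota> b"
    by (simp add: char_two_simps)
  finally show ?thesis
    by (simp add: \<iota>_add \<iota>_mult \<iota>_power)
qed


section \<open>The Barlotti--Cofman representation\<close>

lemma bc_vec_eq_iff [simp]:
  "bc_vec \<iota> \<epsilon> a x y z = bc_vec \<iota> \<epsilon> a' x' y' z' \<longleftrightarrow> a = a' \<and> x = x' \<and> y = y' \<and> z = z'"
  unfolding bc_vec_def vec7_eq_iff vec7_nth by (metis comps_eq_iff prod_eq_iff)

lemma bc_vec_nth_0 [simp]: "bc_vec \<iota> \<epsilon> a x y z $ 0 = a"
  by (simp add: bc_vec_def)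

lemma bc_vec_0 [simp]: "bc_vec \<iota> \<epsilon> 0 0 0 0 = 0"
  by (simp add: bc_vec_def vec7_eq_iff)

lemma bc_vec_eq_0_iff [simp]: "bc_vec \<iota> \<epsilon> a x y z = 0 \<longleftrightarrow> a = 0 \<and> x = 0 \<and> y = 0 \<and> z = 0"
  using bc_vec_eq_iff[of a x y z 0 0 0 0] by simp

lemma bc_vec_add:
  "bc_vec \<iota> \<epsilon> a x y z + bc_vec \<iota> \<epsilon> a' x' y' z' = bc_vec \<iota> \<epsilon> (a + a') (x + x') (y + y') (z + z')"
  by (simp add: bc_vec_def vec7_eq_iff comps_add)

lemma bc_vec_scale:
  "k *s bc_vec \<iota> \<epsilon> a x y z = bc_vec \<iota> \<epsilon> (k * a) (\<iota> k * x) (\<iota> k * y) (\<iota> k * z)"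
  by (simp add: bc_vec_def vec7_eq_iff comps_scale)

lemma pt_vec4_affine_eq_iff [simp]:
  "pt (vec4 1 x y z :: 'l ^ 4) = pt (vec4 1 x' y' z') \<longleftrightarrow> x = x' \<and> y = y' \<and> z = z'"
  by (subst pt_eq_affine_iff) (simp_all add: vec4_eq_iff)

lemma bc_point_affine [simp]: "bc_point \<iota> \<epsilon> (pt (vec4 1 x y z)) = pt (bc_vec \<iota> \<epsilon> 1 x y z)"
  unfolding bc_point_def by (rule the_equality) auto

text \<open>This is the function whose graph, completed by one point at infinity, is the Suzuki-Tits
  ovoid of PG(3,q).\<close>

definition G :: "'k \<Rightarrow> 'k \<Rightarrow> 'k" where
  "G a b = a ^ (\<sigma> + 2) + a * b + b ^ \<sigma>"

text \<open>The equation is stated for vectors, so that representatives can be changed freely before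
  returning to points by \<open>pt_in_hypersurface\<close>.\<close>

definition on_hypersurface :: "'k ^ 7 \<Rightarrow> bool" where
  "on_hypersurface x \<longleftrightarrow>
     (x $ 0) ^ (\<sigma> + 1) * x $ 6 =
       (x $ 1) ^ (\<sigma> + 2) + (x $ 0) ^ \<sigma> * x $ 1 * x $ 2 + (x $ 0) ^ 2 * (x $ 2) ^ \<sigma>
       + (x $ 3) ^ (\<sigma> + 2) + (x $ 0) ^ \<sigma> * x $ 3 * x $ 4 + (x $ 0) ^ 2 * (x $ 4) ^ \<sigma>"

text \<open>Every monomial has degree \<open>\<sigma> + 2\<close>, so a common factor
  \<open>c ^ (\<sigma> + 2)\<close> cancels.\<close>

lemma on_hypersurface_scale:
  assumes "c \<noteq> 0"
  shows "on_hypersurface (c *s x) \<longleftrightarrow> on_hypersurface x"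
proof -
  have eq: "(c * s) ^ (\<sigma> + 1) * (c * z) = c ^ (\<sigma> + 2) * (s ^ (\<sigma> + 1) * z)"
    "(c * s) ^ \<sigma> * (c * u) * (c * v) = c ^ (\<sigma> + 2) * (s ^ \<sigma> * u * v)"
    "(c * s) ^ 2 * (c * u) ^ \<sigma> = c ^ (\<sigma> + 2) * (s ^ 2 * u ^ \<sigma>)"
    "(c * s) ^ (\<sigma> + 2) = c ^ (\<sigma> + 2) * s ^ (\<sigma> + 2)" for s u v z :: 'k
    by (simp_all add: power_mult_distrib power_add power2_eq_square algebra_simps)
  have "c ^ (\<sigma> + 2) \<noteq> 0" using assms by simp
  then show ?thesis
    unfolding on_hypersurface_def vector_smult_component eq
    by (simp only: distrib_left[symmetric] mult_cancel_left simp_thms)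
qed

lemma pt_in_hypersurface: "pt x \<in> BT_hypersurface \<sigma> \<longleftrightarrow> x \<noteq> 0 \<and> on_hypersurface x"
proof
  assume "pt x \<in> BT_hypersurface \<sigma>"
  then obtain y where y: "pt x = pt y" "y \<noteq> 0" "on_hypersurface y"
    unfolding BT_hypersurface_def on_hypersurface_def by blast
  then obtain c where "c \<noteq> 0" "x = c *s y" by (auto simp: pt_eq_iff)
  with y show "x \<noteq> 0 \<and> on_hypersurface x" by (simp add: on_hypersurface_scale)
qed (auto simp: BT_hypersurface_def on_hypersurface_def)

lemma on_hypersurface_affine:
  "x $ 0 = 1 \<Longrightarrow> on_hypersurface x \<longleftrightarrow> x $ 6 = G (x $ 1) (x $ 2) + G (x $ 3) (x $ 4)"
  by (simp add: on_hypersurface_def G_def add.assoc)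

lemma \<sigma>_pos: "\<sigma> > 0"
  by (simp add: \<sigma>)

lemma on_hypersurface_infinite:
  assumes "x $ 0 = 0"
  shows "on_hypersurface x \<longleftrightarrow> x $ 1 = x $ 3"
proof -
  \<comment> \<open>Oddness makes the division in the exponent of \<open>\<sigma>\<close> exact,
    with value \<open>m + 1\<close>.\<close>
  obtain m where "e = 2 * m + 1" using odd_e by (elim oddE)
  then have "\<sigma> = 2 ^ (m + 1)" "CARD('k) = 2 ^ (2 * m + 1)"
    by (simp_all add: \<sigma> card_k q)
  then have inj: "a ^ (\<sigma> + 2) = b ^ (\<sigma> + 2) \<Longrightarrow> a = b" for a b :: 'k
    using power_sigma_plus_two_inj[of m a b] by simp
  \<comment> \<open>Positivity of \<open>\<sigma>\<close> is what makes the terms with factor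
    \<open>(x $ 0) ^ \<sigma>\<close> vanish.\<close>
  have "on_hypersurface x \<longleftrightarrow> (x $ 1) ^ (\<sigma> + 2) + (x $ 3) ^ (\<sigma> + 2) = 0"
    using \<sigma>_pos by (auto simp: on_hypersurface_def assms power_0_left)
  then show ?thesis
    unfolding add_eq_0_iff_k by (metis inj)
qed

text \<open>Adding a multiple of \<open>?V\<close> changes only coordinate 5, which does not occur
  in the equation.\<close>

lemma cone_affine: "BT_cone \<sigma> \<inter> affine_points = BT_hypersurface \<sigma> \<inter> (affine_points :: ('k ^ 7) set set)"
proof (intro set_eqI)
  fix P :: "('k ^ 7) set"
  let ?V = "vec7 0 0 0 0 0 1 0 :: 'k ^ 7"
  show "P \<in> BT_cone \<sigma> \<inter> affine_points \<longleftrightarrow> P \<in> BT_hypersurface \<sigma> \<inter> affine_points"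
  proof (cases "P \<in> affine_points")
    case True
    then obtain v where v0: "v $ 0 = 1" and P: "P = pt v" by (rule affine_point_cases)
    then have nz: "v \<noteq> 0" by auto
    have "P \<in> BT_cone \<sigma> \<longleftrightarrow> on_hypersurface v"
    proof
      assume "P \<in> BT_cone \<sigma>"
      then obtain x where x: "x \<noteq> 0" "on_hypersurface x" "P \<in> join_line (pt ?V) (pt x)"
        unfolding BT_cone_def BT_hypersurface_def on_hypersurface_def by blast
      then obtain c d where cd: "v = c *s ?V + d *s x" by (auto simp: P pt_in_join_line)
      \<comment> \<open>The vertex has coordinate 0 equal to 0, so \<open>d = 0\<close> would
        contradict \<open>v $ 0 = 1\<close>.\<close>
      with v0 have "d \<noteq> 0" by auto
      with x have "on_hypersurface (d *s x)" by (simp add: on_hypersurface_scale)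
      then show "on_hypersurface v"
        by (simp add: cd on_hypersurface_def)
    next
      assume v: "on_hypersurface v"
      \<comment> \<open>The base point is the projection of \<open>v\<close> from the vertex onto
        x_5 = 0.\<close>
      define x where "x = v - (v $ 5) *s ?V"
      have x0: "x $ 0 = 1" by (simp add: x_def v0)
      then have "x \<noteq> 0" by auto
      moreover have "on_hypersurface x"
        using v by (simp add: x_def on_hypersurface_def)
      ultimately have "pt x \<in> BT_hypersurface \<sigma>" by (simp add: pt_in_hypersurface)
      moreover have "\<forall>w\<in>pt x. w $ 5 = 0" by (auto simp: mem_pt x_def)
      moreover have "P \<in> join_line (pt ?V) (pt x)"
        unfolding P pt_in_join_line
        by (intro conjI nz exI[of _ "v $ 5"] exI[of _ 1]) (simp add: x_def)
      ultimately show "P \<in> BT_cone \<sigma>" unfolding BT_cone_def by blast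
    qed
    with True nz show ?thesis by (simp add: P pt_in_hypersurface)
  qed simp
qed

section \<open>The variety, split into affine points and points at infinity\<close>

lemma BT_infinity_subset: "BT_infinity q \<subseteq> infinite_points"
  by (auto simp: BT_infinity_def vec4_eq_iff)

lemma variety_infinite: "BT_variety q \<sigma> \<epsilon> \<inter> infinite_points = BT_infinity q"
  using BT_infinity_subset by (auto simp: BT_variety_def)

lemma variety_affine:
  "BT_variety q \<sigma> \<epsilon> \<inter> affine_points =
     {pt (vec4 1 x y z) | x y z. z ^ q + z = BT_Gamma q \<sigma> \<epsilon> x + BT_Gamma q \<sigma> \<epsilon> y}"
  using BT_infinity_subset by (auto simp: BT_variety_def affine_points_def vec4_eq_iff)

text \<open>The trace of \<open>z\<close> is the image of its second component, that is of x_6, and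
  both Gamma values also come from the subfield; injectivity of \<open>\<iota>\<close> transfers the
  equation.\<close>

lemma variety_equation_iff:
  "z ^ q + z = BT_Gamma q \<sigma> \<epsilon> x + BT_Gamma q \<sigma> \<epsilon> y \<longleftrightarrow> on_hypersurface (bc_vec \<iota> \<epsilon> 1 x y z)"
proof -
  obtain a b c d f g where "x = \<iota> a + \<epsilon> * \<iota> b" "y = \<iota> c + \<epsilon> * \<iota> d" "z = \<iota> f + \<epsilon> * \<iota> g"
    using decomp_ex by metis
  moreover have "\<iota> g = \<iota> (G a b) + \<iota> (G c d) \<longleftrightarrow> g = G a b + G c d"
    by (simp flip: \<iota>_add)
  ultimately show ?thesis
    by (simp add: trace_decomp Gamma_decomp on_hypersurface_affine bc_vec_def G_def)
qed

lemma bij_betw_affine: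
  "bij_betw (bc_point \<iota> \<epsilon>) (BT_variety q \<sigma> \<epsilon> \<inter> affine_points) (BT_hypersurface \<sigma> \<inter> affine_points)"
  unfolding bij_betw_def
proof
  show "inj_on (bc_point \<iota> \<epsilon>) (BT_variety q \<sigma> \<epsilon> \<inter> affine_points)"
    by (auto simp: inj_on_def variety_affine pt_eq_affine_iff)
  show "bc_point \<iota> \<epsilon> ` (BT_variety q \<sigma> \<epsilon> \<inter> affine_points) = BT_hypersurface \<sigma> \<inter> affine_points"
  proof (intro equalityI subsetI)
    fix Q assume "Q \<in> bc_point \<iota> \<epsilon> ` (BT_variety q \<sigma> \<epsilon> \<inter> affine_points)"
    then show "Q \<in> BT_hypersurface \<sigma> \<inter> affine_points"
      by (auto simp: variety_affine pt_in_hypersurface variety_equation_iff)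
  next
    fix Q :: "('k ^ 7) set" assume Q: "Q \<in> BT_hypersurface \<sigma> \<inter> affine_points"
    then obtain v where v: "v $ 0 = 1" "Q = pt v" by (blast elim: affine_point_cases)
    \<comment> \<open>The preimage is assembled from consecutive pairs of coordinates.\<close>
    define x y z where "x = \<iota> (v $ 1) + \<epsilon> * \<iota> (v $ 2)" and "y = \<iota> (v $ 3) + \<epsilon> * \<iota> (v $ 4)"
      and "z = \<iota> (v $ 5) + \<epsilon> * \<iota> (v $ 6)"
    have "v = bc_vec \<iota> \<epsilon> 1 x y z"
      by (simp add: bc_vec_def vec7_eq_iff v x_def y_def z_def)
    with Q v have "on_hypersurface (bc_vec \<iota> \<epsilon> 1 x y z)" "Q = bc_point \<iota> \<epsilon> (pt (vec4 1 x y z))"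
      by (simp_all add: pt_in_hypersurface)
    then show "Q \<in> bc_point \<iota> \<epsilon> ` (BT_variety q \<sigma> \<epsilon> \<inter> affine_points)"
      unfolding variety_affine variety_equation_iff by blast
  qed
qed

section \<open>Spread lines\<close>

text \<open>Fixes one representative of the point: the scalar relating it to any other is absorbed
  into \<open>l\<close>.\<close>

lemma bc_line_pt:
  "bc_line \<iota> \<epsilon> (pt (vec4 0 u v w)) = {pt (bc_vec \<iota> \<epsilon> 0 (l * u) (l * v) (l * w)) | l. l \<noteq> 0}"
proof (intro equalityI subsetI)
  fix Q assume "Q \<in> bc_line \<iota> \<epsilon> (pt (vec4 0 u v w))"
  then obtain l u' v' w' where Q: "Q = pt (bc_vec \<iota> \<epsilon> 0 (l * u') (l * v') (l * w'))" "l \<noteq> 0"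
    and "pt (vec4 0 u' v' w') = pt (vec4 0 u v w)"
    unfolding bc_line_def by auto
  then obtain c where "c \<noteq> 0" "u' = c * u" "v' = c * v" "w' = c * w"
    by (auto simp: pt_eq_iff vec4_eq_iff)
  with Q have "Q = pt (bc_vec \<iota> \<epsilon> 0 (l * c * u) (l * c * v) (l * c * w)) \<and> l * c \<noteq> 0"
    by (simp add: mult.assoc)
  then show "Q \<in> {pt (bc_vec \<iota> \<epsilon> 0 (l * u) (l * v) (l * w)) | l. l \<noteq> 0}" by blast
qed (auto simp: bc_line_def)

text \<open>The parametrization \<open>f\<close> is injective and linear over the subfield, so its
  range is a plane of vectors with basis \<open>f 1\<close>, \<open>f \<epsilon>\<close>.\<close>

lemma bc_line_is_line:
  assumes nz: "(u, v, w) \<noteq> (0, 0, 0)"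
  shows "is_proj_line (bc_line \<iota> \<epsilon> (pt (vec4 0 u v w)))"
proof -
  define f where "f l = bc_vec \<iota> \<epsilon> 0 (l * u) (l * v) (l * w)" for l
  have add: "f l + f l' = f (l + l')" for l l'
    by (simp add: f_def bc_vec_add distrib_right)
  have scale: "k *s f l = f (\<iota> k * l)" for k l
    by (simp add: f_def bc_vec_scale mult.assoc)
  have inj: "f l = f l' \<longleftrightarrow> l = l'" for l l'
    using nz by (auto simp: f_def)
  have f_0: "f l = 0 \<longleftrightarrow> l = 0" for l
    using nz by (auto simp: f_def)
  have sub: "vec.subspace (range f)"
    unfolding vec.subspace_def using f_0[of 0] by (auto simp: add scale image_iff)
  \<comment> \<open>A dependence would give 1 = \<open>\<epsilon> * \<iota> k\<close>, against
    uniqueness of the decomposition.\<close>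
  have f_1: "f 1 \<notin> vec.span {f \<epsilon>}"
  proof
    assume "f 1 \<in> vec.span {f \<epsilon>}"
    then obtain k where "f 1 = k *s f \<epsilon>" by (auto simp: vec.span_singleton)
    then have "\<iota> 1 + \<epsilon> * \<iota> 0 = \<iota> 0 + \<epsilon> * \<iota> k" by (simp add: scale inj mult.commute)
    then show False unfolding decomp_unique by simp
  qed
  have "range f \<subseteq> vec.span {f 1, f \<epsilon>}"
  proof
    fix x assume "x \<in> range f"
    then obtain a b where "x = f (\<iota> a + \<epsilon> * \<iota> b)" using decomp_ex by (metis imageE)
    then have "x = a *s f 1 + b *s f \<epsilon>" by (simp add: scale add mult.commute)
    then show "x \<in> vec.span {f 1, f \<epsilon>}"
      by (auto intro!: vec.span_add vec.span_scale intro: vec.span_base)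
  qed
  moreover have "vec.span {f 1, f \<epsilon>} \<subseteq> range f"
    by (rule vec.span_minimal[OF _ sub]) auto
  ultimately have "vec.dim (range f) = vec.dim {f 1, f \<epsilon>}"
    by (metis subset_antisym vec.dim_span)
  \<comment> \<open>\<open>\<iota>_0\<close> puts 0 into the range of \<open>\<iota>\<close>; hence
    \<open>\<epsilon>\<close> and \<open>f \<epsilon>\<close> are nonzero.\<close>
  also have "vec.dim {f 1, f \<epsilon>} = 2"
    using f_1 f_0[of \<epsilon>] \<epsilon>_notin \<iota>_0 by (auto simp: vec.dim_insert simp del: \<iota>_0)
  finally have dim: "vec.dim (range f) = 2" .
  have "bc_line \<iota> \<epsilon> (pt (vec4 0 u v w)) = {R \<in> proj_points. R \<subseteq> range f}"
  proof (intro equalityI subsetI)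
    fix R assume "R \<in> bc_line \<iota> \<epsilon> (pt (vec4 0 u v w))"
    then obtain l where "R = pt (f l)" "l \<noteq> 0" by (auto simp: bc_line_pt f_def)
    then show "R \<in> {R \<in> proj_points. R \<subseteq> range f}"
      by (simp add: f_0 pt_subset_iff[OF sub])
  next
    fix R assume "R \<in> {R \<in> proj_points. R \<subseteq> range f}"
    then obtain x where x: "x \<noteq> 0" "R = pt x" "x \<in> range f"
      by (auto simp: mem_proj_points pt_subset_iff[OF sub])
    then obtain l where "x = f l" by auto
    with x have "R = pt (f l) \<and> l \<noteq> 0" by (auto simp: f_0)
    then show "R \<in> bc_line \<iota> \<epsilon> (pt (vec4 0 u v w))"
      unfolding bc_line_pt f_def by blast
  qed
  with sub dim show ?thesis unfolding is_proj_line_def by blast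
qed

lemma bc_line_infinite:
  assumes "(u, v, w) \<noteq> (0, 0, 0)"
  shows "bc_line \<iota> \<epsilon> (pt (vec4 0 u v w)) \<subseteq> infinite_points"
  using assms by (auto simp: bc_line_pt)

text \<open>The point with parameter 1 on the first line also lies on the second; this makes the two
  coordinate triples proportional with factor \<open>\<iota> c * l\<close>.\<close>

lemma bc_line_inj:
  assumes "bc_line \<iota> \<epsilon> (pt (vec4 0 u v w)) = bc_line \<iota> \<epsilon> (pt (vec4 0 u' v' w'))"
  shows "pt (vec4 0 u v w) = pt (vec4 0 u' v' w')"
proof -
  have "pt (bc_vec \<iota> \<epsilon> 0 (1 * u) (1 * v) (1 * w)) \<in> bc_line \<iota> \<epsilon> (pt (vec4 0 u v w))"
    unfolding bc_line_pt by (intro CollectI exI[of _ 1] conjI) auto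
  then obtain l where l: "l \<noteq> 0"
    and eq: "pt (bc_vec \<iota> \<epsilon> 0 u v w) = pt (bc_vec \<iota> \<epsilon> 0 (l * u') (l * v') (l * w'))"
    unfolding assms unfolding bc_line_pt by auto
  then obtain c where "c \<noteq> 0" "u = \<iota> c * (l * u')" "v = \<iota> c * (l * v')" "w = \<iota> c * (l * w')"
    by (auto simp: pt_eq_iff bc_vec_scale)
  with l have "\<iota> c * l \<noteq> 0 \<and> vec4 0 u v w = (\<iota> c * l) *s vec4 0 u' v' w'"
    by (simp add: vec4_eq_iff mult.assoc)
  then show ?thesis unfolding pt_eq_iff by blast
qed

lemma inj_on_bc_line: "inj_on (bc_line \<iota> \<epsilon>) (BT_infinity q)"
proof (rule inj_onI)
  fix P Q assume "P \<in> BT_infinity q" "Q \<in> BT_infinity q" and eq: "bc_line \<iota> \<epsilon> P = bc_line \<iota> \<epsilon> Q"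
  then obtain u v w u' v' w' where P: "P = pt (vec4 0 u v w)" and Q: "Q = pt (vec4 0 u' v' w')"
    unfolding BT_infinity_def by blast
  from eq show "P = Q"
    unfolding P Q by (rule bc_line_inj)
qed

text \<open>If \<open>u \<noteq> v\<close>, scaling by \<open>l = 1 / (u + v)\<close> gives a point with $x_1 + x_3 = 1$.\<close>

lemma bc_line_subset_hypersurface:
  assumes "(u, v, w) \<noteq> (0, 0, 0)"
  shows "bc_line \<iota> \<epsilon> (pt (vec4 0 u v w)) \<subseteq> BT_hypersurface \<sigma> \<longleftrightarrow> u = v"
proof -
  \<comment> \<open>The condition x_1 = x_3 becomes the vanishing of one first component, because
    taking components is additive.\<close>
  have "on_hypersurface (bc_vec \<iota> \<epsilon> 0 (l * u) (l * v) (l * w)) \<longleftrightarrow> fst (comps \<iota> \<epsilon> (l * (u + v))) = 0"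
    for l
    by (simp add: on_hypersurface_infinite bc_vec_def distrib_left comps_add add_eq_0_iff_k)
  then have "bc_line \<iota> \<epsilon> (pt (vec4 0 u v w)) \<subseteq> BT_hypersurface \<sigma>
      \<longleftrightarrow> (\<forall>l. l \<noteq> 0 \<longrightarrow> fst (comps \<iota> \<epsilon> (l * (u + v))) = 0)"
    using assms by (auto simp: bc_line_pt pt_in_hypersurface)
  also have "\<dots> \<longleftrightarrow> u + v = 0"
  proof
    assume all: "\<forall>l. l \<noteq> 0 \<longrightarrow> fst (comps \<iota> \<epsilon> (l * (u + v))) = 0"
    show "u + v = 0"
    proof (rule ccontr)
      assume "u + v \<noteq> 0"
      with all[rule_format, of "1 / (u + v)"] show False by simp
    qed
  qed simp
  finally show ?thesis by (simp add: add_eq_0_iff_l)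
qed

section \<open>Counting\<close>

text \<open>Normal forms for counting: \<open>X = 0\<close> forces \<open>Y = 0\<close> and leaves a
  single point, otherwise scaling gives \<open>X = 1\<close> and \<open>Y\<close> of norm
  one.\<close>

lemma BT_infinity_eq:
  "BT_infinity q = insert (pt (vec4 0 0 0 1))
     ((\<lambda>(Y, Z). pt (vec4 0 1 Y Z)) ` ({Y :: 'l. Y ^ (q + 1) = 1} \<times> UNIV))" (is "_ = ?R")
proof (intro equalityI subsetI)
  fix P :: "('l ^ 4) set" assume "P \<in> BT_infinity q"
  then obtain X Y Z where P: "P = pt (vec4 0 X Y Z)" and nz: "(X, Y, Z) \<noteq> (0, 0, 0)"
    and eq: "X ^ (q + 1) = Y ^ (q + 1)"
    by (auto simp: BT_infinity_def add_eq_0_iff_l simp del: power_Suc)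
  show "P \<in> ?R"
  proof (cases "X = 0")
    case True
    with eq have "Y ^ (q + 1) = 0" by simp
    then have "Y = 0" by (metis power_not_zero)
    with True nz have "Z \<noteq> 0" by simp
    then have "P = pt (vec4 0 0 0 1)"
      unfolding P pt_eq_iff by (intro exI[of _ Z]) (simp add: True \<open>Y = 0\<close> vec4_eq_iff)
    then show ?thesis by simp
  next
    case False
    then have "P = pt (vec4 0 1 (Y / X) (Z / X))"
      unfolding P pt_eq_iff by (intro exI[of _ X]) (simp add: vec4_eq_iff)
    moreover have "(Y / X) ^ (q + 1) = 1"
      unfolding power_divide eq[symmetric] using False by simp
    ultimately show ?thesis by auto
  qed
next
  fix P :: "('l ^ 4) set" assume "P \<in> ?R"
  then consider "P = pt (vec4 0 0 0 1)"
    | Y Z where "P = pt (vec4 0 1 Y Z)" "Y ^ (q + 1) = 1" by auto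
  then show "P \<in> BT_infinity q"
  proof cases
    case 1
    then show ?thesis
      unfolding BT_infinity_def by (intro CollectI exI[of _ 0] exI[of _ 1]) auto
  next
    case 2
    then show ?thesis
      unfolding BT_infinity_def
      by (intro CollectI exI[of _ 1] exI[of _ Y] exI[of _ Z]) (simp add: add_self_l del: power_Suc)
  qed
qed

lemma pt_vec4_infinite_inj: "inj_on (\<lambda>(Y, Z). pt (vec4 0 1 Y Z :: 'l ^ 4)) A"
  by (auto simp: inj_on_def pt_eq_iff vec4_eq_iff)

lemma pt_vec4_0001_notin: "pt (vec4 0 0 0 1) \<notin> (\<lambda>(Y, Z). pt (vec4 0 1 Y Z :: 'l ^ 4)) ` A"
  by (auto simp: pt_eq_iff vec4_eq_iff)

lemma card_BT_infinity: "card (BT_infinity q :: ('l ^ 4) set set) = q ^ 3 + q ^ 2 + 1"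
proof -
  have "card (BT_infinity q :: ('l ^ 4) set set) = Suc ((q + 1) * q ^ 2)"
    unfolding BT_infinity_eq
    by (simp add: pt_vec4_0001_notin card_image[OF pt_vec4_infinite_inj] card_cartesian_product
        card_l card_norm_one[OF card_l q_gt_1, unfolded One_nat_def add_Suc_right add_0_right] del: power_Suc)
  then show ?thesis by (simp add: power2_eq_square power3_eq_cube algebra_simps)
qed

text \<open>Among the normal forms, equality of the first two coordinates at infinity holds for the
  isolated point and for \<open>Y = 1\<close>, which does have norm one.\<close>

lemma BT_infinity_lines_in_hypersurface:
  "{P \<in> BT_infinity q. bc_line \<iota> \<epsilon> P \<subseteq> BT_hypersurface \<sigma>} =
     insert (pt (vec4 0 0 0 1)) ((\<lambda>(Y, Z). pt (vec4 0 1 Y Z)) ` ({1} \<times> UNIV))"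
proof -
  let ?f = "\<lambda>(Y, Z). pt (vec4 0 1 Y Z) :: ('l ^ 4) set" and ?A = "{Y :: 'l. Y ^ (q + 1) = 1} \<times> UNIV"
  define inside where "inside P \<longleftrightarrow> bc_line \<iota> \<epsilon> P \<subseteq> BT_hypersurface \<sigma>" for P
  have inside_0: "inside (pt (vec4 0 0 0 1))"
    and "inside (pt (vec4 0 1 Y Z)) \<longleftrightarrow> 1 = Y" for Y Z
    unfolding inside_def by (subst bc_line_subset_hypersurface; simp)+
  then have units: "{YZ \<in> ?A. inside (?f YZ)} = {1} \<times> UNIV"
    by (auto simp del: power_Suc)
  have "{P \<in> BT_infinity q. inside P} = insert (pt (vec4 0 0 0 1)) (?f ` {YZ \<in> ?A. inside (?f YZ)})"
    unfolding BT_infinity_eq using inside_0 by blast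
  then show ?thesis
    unfolding units unfolding inside_def .
qed

lemma card_lines_in_hypersurface:
  "card {r \<in> bc_line \<iota> \<epsilon> ` BT_infinity q. r \<subseteq> BT_hypersurface \<sigma>} = q ^ 2 + 1"
proof -
  have "{r \<in> bc_line \<iota> \<epsilon> ` BT_infinity q. r \<subseteq> BT_hypersurface \<sigma>} =
      bc_line \<iota> \<epsilon> ` {P \<in> BT_infinity q. bc_line \<iota> \<epsilon> P \<subseteq> BT_hypersurface \<sigma>}"
    by auto
  \<comment> \<open>Injectivity of \<open>bc_line\<close> replaces the count of lines by a count of
    points.\<close>
  also have "card \<dots> = card {P \<in> BT_infinity q. bc_line \<iota> \<epsilon> P \<subseteq> BT_hypersurface \<sigma>}"
    by (intro card_image inj_on_subset[OF inj_on_bc_line]) auto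
  also have "\<dots> = q ^ 2 + 1"
    unfolding BT_infinity_lines_in_hypersurface
    by (simp add: pt_vec4_0001_notin card_image[OF pt_vec4_infinite_inj] card_cartesian_product card_l)
  finally show ?thesis .
qed

end

theorem theorem7p5:
  fixes \<iota> :: "'k::{field,finite} \<Rightarrow> 'l::{field,finite}"
    and \<delta> :: 'k and \<epsilon> :: 'l and e q \<sigma> :: nat
  assumes "odd e" and "e > 1"
    and "q = 2 ^ e" and "\<sigma> = 2 ^ ((e + 1) div 2)"
    and "CARD('k) = q" and "CARD('l) = q ^ 2" and "field_embedding \<iota>"
    and "abs_trace e \<delta> = 1"
    and "\<epsilon> \<notin> range \<iota>" and "\<epsilon> ^ 2 + \<epsilon> + \<iota> \<delta> = 0"
  shows "bij_betw (bc_point \<iota> \<epsilon>)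
           (BT_variety q \<sigma> \<epsilon> \<inter> affine_points) (BT_hypersurface \<sigma> \<inter> affine_points)
       \<and> bij_betw (bc_point \<iota> \<epsilon>)
           (BT_variety q \<sigma> \<epsilon> \<inter> affine_points) (BT_cone \<sigma> \<inter> affine_points)
       \<and> BT_variety q \<sigma> \<epsilon> \<inter> infinite_points = BT_infinity q
       \<and> (\<forall>P \<in> BT_infinity q. is_proj_line (bc_line \<iota> \<epsilon> P) \<and> bc_line \<iota> \<epsilon> P \<subseteq> infinite_points)
       \<and> inj_on (bc_line \<iota> \<epsilon>) (BT_infinity q)
       \<and> card (bc_line \<iota> \<epsilon> ` BT_infinity q) = q ^ 3 + q ^ 2 + 1
       \<and> card {r \<in> bc_line \<iota> \<epsilon> ` BT_infinity q. r \<subseteq> BT_hypersurface \<sigma>} = q ^ 2 + 1"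
proof -
  interpret BT_setting \<iota> \<delta> \<epsilon> e q \<sigma>
    by unfold_locales (fact assms)+
  have lines: "is_proj_line (bc_line \<iota> \<epsilon> P) \<and> bc_line \<iota> \<epsilon> P \<subseteq> infinite_points"
    if "P \<in> BT_infinity q" for P
  proof -
    from that obtain u v w where "P = pt (vec4 0 u v w)" "(u, v, w) \<noteq> (0, 0, 0)"
      unfolding BT_infinity_def by blast
    then show ?thesis
      using bc_line_is_line bc_line_infinite by blast
  qed
  have card: "card (bc_line \<iota> \<epsilon> ` BT_infinity q) = q ^ 3 + q ^ 2 + 1"
    unfolding card_image[OF inj_on_bc_line] by (rule card_BT_infinity)
  have cone: "bij_betw (bc_point \<iota> \<epsilon>)
      (BT_variety q \<sigma> \<epsilon> \<inter> affine_points) (BT_cone \<sigma> \<inter> affine_points)"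
    unfolding cone_affine by (rule bij_betw_affine)
  show ?thesis
    by (rule conjI bij_betw_affine cone variety_infinite ballI lines inj_on_bc_line card
        card_lines_in_hypersurface | assumption)+
qed

end
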